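(* Let $\mathcal{M}_1=(E,\mathcal{I}_1)$ be a matroid of rank $r$ with set of bases $\mathcal{X}_1$, and let $o:E\to\mathcal{C}=\{\eta_1,\dots,\eta_K\}$ assign one of $K$ ordered categories to each element of $E$. Consider the matroid problem with ordinal costs (MPO): minimize $o(B)$ subject to $B\in\mathcal{X}_1$, where minimization is understood with respect to ordinal dominance. Then the ordinally non-dominated set of (MPO) can be computed by a greedy algorithm.
   Context: Matroid: a pair $(E,\mathcal{I})$ with $E$ a finite set and $\mathcal{I}\subseteq 2^E$ such that (i) $\emptyset\in\mathcal{I}$; (ii) $I\in\mathcal{I}$ and $J\subseteq I$ imply $J\in\mathcal{I}$; (iii) for $I,J\in\mathcal{I}$ with $|I|<|J|$ there is $j\in J\setminus I$ with $I\cup\{j\}\in\mathcal{I}$. The sets in $\mathcal{I}$ are called independent. Bases are the inclusion-wise maximal independent sets; they all have the same cardinality $r$, the rank of the matroid. Ordinal setting: the categories are ordered by $\eta_i\prec\eta_j$ iff $i<j$ (meaning $\eta_i$ is strictly preferred over $\eta_j$), and $\eta_i\preceq\eta_j$ iff $i\le j$. For a basis $B$, by slight abuse of notation, $o(B)=(o_1(B),\dots,o_r(B))\in\mathcal{C}^r$ denotes the vector of the categories of the elements of $B$, sorted in non-decreasing order. For bases $B_1,B_2$, $o(B_1)$ ordinally dominates $o(B_2)$, written $o(B_1)\preccurlyeq o(B_2)$, if $o_i(B_1)\preceq o_i(B_2)$ for all $i=1,\dots,r$ and $o(B_1)\neq o(B_2)$. A basis $\bar B\in\mathcal{X}_1$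 is (ordinally) efficient for (MPO) if there is no $B\in\mathcal{X}_1$ with $o(B)\preccurlyeq o(\bar B)$. The ordinally non-dominated set of (MPO) is the set of outcome vectors $\{o(\bar B):\bar B\in\mathcal{X}_1\text{ efficient for (MPO)}\}$. The term "greedy algorithm" is used in the usual sense of matroid optimization; no particular variant is specified in the statement. *)

theory Defs
  imports Main "HOL-Library.Multiset"
begin

locale matroid =
  fixes E :: "'a set" and \<I> :: "'a set set"
  assumes finite_ground: "finite E"
    and indep_subset_ground: "\<I> \<subseteq> Pow E"
    and empty_indep: "{} \<in> \<I>"
    and indep_hereditary: "I \<in> \<I> \<Longrightarrow> J \<subseteq> I \<Longrightarrow> J \<in> \<I>"
    and augmentation:
      "I \<in> \<I> \<Longrightarrow> J \<in> \<I> \<Longrightarrow> card I < card J \<Longrightarrow> \<exists>j \<in> J - I. insert j I \<in> \<I>"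

definition bases :: "'a set set \<Rightarrow> 'a set set" where
  "bases \<I> = {B \<in> \<I>. \<forall>J \<in> \<I>. B \<subseteq> J \<longrightarrow> J = B}"

text \<open>The category \<open>\<eta>\<^sub>i\<close> is represented by its index \<open>i\<close>, so preference among categories
  is the order on \<open>nat\<close>: smaller is better.\<close>

definition outcome :: "('a \<Rightarrow> nat) \<Rightarrow> 'a set \<Rightarrow> nat list" where
  "outcome c B = sorted_list_of_multiset (image_mset c (mset_set B))"

text \<open>\<open>r\<close> is the common cardinality of the bases, that is, the length of their outcome vectors.\<close>

definition ordinally_dominates :: "nat \<Rightarrow> ('a \<Rightarrow> nat) \<Rightarrow> 'a set \<Rightarrow> 'a set \<Rightarrow> bool" where
  "ordinally_dominates r c B\<^sub>1 B\<^sub>2 \<longleftrightarrow>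
     (\<forall>i<r. outcome c B\<^sub>1 ! i \<le> outcome c B\<^sub>2 ! i) \<and> outcome c B\<^sub>1 \<noteq> outcome c B\<^sub>2"

definition efficient_bases :: "'a set set \<Rightarrow> nat \<Rightarrow> ('a \<Rightarrow> nat) \<Rightarrow> 'a set set" where
  "efficient_bases \<I> r c =
     {B \<in> bases \<I>. \<not> (\<exists>B' \<in> bases \<I>. ordinally_dominates r c B' B)}"

definition nondominated_set :: "'a set set \<Rightarrow> nat \<Rightarrow> ('a \<Rightarrow> nat) \<Rightarrow> nat list set" where
  "nondominated_set \<I> r c = outcome c ` efficient_bases \<I> r c"

text \<open>The matroid greedy algorithm on a list \<open>es\<close> of the ground set. Since \<open>sort_key\<close> is
  stable, the order of \<open>es\<close> determines how ties between equal categories are broken, and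
  every tie-breaking arises from some \<open>es\<close>.\<close>

definition greedy :: "'a set set \<Rightarrow> ('a \<Rightarrow> nat) \<Rightarrow> 'a list \<Rightarrow> 'a set" where
  "greedy \<I> c es =
     fold (\<lambda>e B. if insert e B \<in> \<I> then insert e B else B) (sort_key c es) {}"

end

(* If a basis had more elements of category at most k than the greedy basis G, augmentation would
   yield an element that greedy rejected although it keeps the part of G up to its own category
   independent, which is impossible.  So G has the most elements in every lower category class among
   all bases, which for sorted vectors means that its outcome is componentwise minimal. *)
theory Submission
  imports Defs
begin

abbreviation greedy_step :: "'a set set \<Rightarrow> 'a \<Rightarrow> 'a set \<Rightarrow> 'a set" where
  "greedy_step \<I> e B \<equiv> if insert e B \<in> \<I> then insert e B else B"

lemma fold_greedy_step_indep:
  "A \<in> \<I> \<Longrightarrow> fold (greedy_step \<I>) xs A \<in> \<I>"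
  by (induction xs arbitrary: A) auto

lemma fold_greedy_step_subset:
  "fold (greedy_step \<I>) xs A \<subseteq> A \<union> set xs"
  by (induction xs rule: rev_induct) auto

context matroid
begin

text \<open>When \<open>e\<close> is tried, sortedness ensures that every element accepted so far
  has category at most \<open>c e\<close>. The set that made \<open>e\<close> fail therefore lies
  inside the part of the final set up to \<open>c e\<close>, and dependence passes to supersets by
  heredity.\<close>

lemma fold_greedy_step_rejected:
  assumes "sorted (map c xs)" "e \<in> set xs" "e \<notin> fold (greedy_step \<I>) xs {}"
  shows "insert e {g \<in> fold (greedy_step \<I>) xs {}. c g \<le> c e} \<notin> \<I>"
  using assms
proof (induction xs rule: rev_induct)
  case Nil
  then show ?case by simp
next
  case (snoc x xs)
  define G where "G = fold (greedy_step \<I>) xs {}"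
  define G' where "G' = fold (greedy_step \<I>) (xs @ [x]) {}"
  have G': "G' = greedy_step \<I> x G"
    by (simp add: G_def G'_def)
  have e: "e \<notin> G'"
    using snoc.prems(3) by (simp add: G'_def)
  have "insert e {g \<in> G'. c g \<le> c e} \<notin> \<I>"
  proof (cases "e \<in> set xs")
    case True
    have "e \<notin> G"
      using e G' by (auto split: if_splits)
    then have "insert e {g \<in> G. c g \<le> c e} \<notin> \<I>"
      using snoc.IH snoc.prems(1) True by (simp add: G_def sorted_append)
    \<comment> \<open>The last step can only enlarge \<open>G\<close>, so a dependent set from
      before stays inside the new one.\<close>
    moreover have "insert e {g \<in> G. c g \<le> c e} \<subseteq> insert e {g \<in> G'. c g \<le> c e}"
      using G' by auto
    ultimately show ?thesis
      using indep_hereditary by blast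
  next
    case False
    then have "e = x"
      using snoc.prems(2) by simp
    then have "G' = G" "insert x G \<notin> \<I>"
      using e G' by (auto split: if_splits)
    \<comment> \<open>As \<open>x\<close> comes last in sorted order, the restriction by category
      removes nothing, and the rejection of \<open>x\<close> is already the claim.\<close>
    moreover have "{g \<in> G. c g \<le> c x} = G"
      using snoc.prems(1) fold_greedy_step_subset[of \<I> xs "{}"]
      by (auto simp: G_def sorted_append)
    ultimately show ?thesis
      using \<open>e = x\<close> by simp
  qed
  then show ?case
    by (simp add: G'_def)
qed

lemma indep_finite: "I \<in> \<I> \<Longrightarrow> finite I"
  using indep_subset_ground finite_ground by (blast intro: finite_subset)

lemma greedy_indep: "greedy \<I> c es \<in> \<I>"
  unfolding greedy_def using empty_indep by (rule fold_greedy_step_indep)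

lemma greedy_rejected:
  assumes "e \<in> set es" "e \<notin> greedy \<I> c es"
  shows "insert e {g \<in> greedy \<I> c es. c g \<le> c e} \<notin> \<I>"
  using fold_greedy_step_rejected[of c "sort_key c es" e] assms by (simp add: greedy_def)

text \<open>A strictly larger independent set would contain a rejected element together with the
  accepted ones that block it.\<close>

lemma greedy_in_bases:
  assumes "set es = E"
  shows "greedy \<I> c es \<in> bases \<I>"
proof -
  have "J = greedy \<I> c es" if J: "J \<in> \<I>" "greedy \<I> c es \<subseteq> J" for J
  proof (rule ccontr)
    assume "J \<noteq> greedy \<I> c es"
    then obtain j where j: "j \<in> J" "j \<notin> greedy \<I> c es"
      using J(2) by blast
    then have "j \<in> set es"
      using J(1) indep_subset_ground assms by blast
    then have "insert j {g \<in> greedy \<I> c es. c g \<le> c j} \<notin> \<I>"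
      using j(2) by (rule greedy_rejected)
    moreover have "insert j {g \<in> greedy \<I> c es. c g \<le> c j} \<subseteq> J"
      using j(1) J(2) by blast
    ultimately show False
      using J(1) indep_hereditary by blast
  qed
  then show ?thesis
    using greedy_indep by (simp add: bases_def)
qed

lemma card_lower_le_greedy:
  assumes "set es = E" "B \<in> \<I>"
  shows "card {b \<in> B. c b \<le> k} \<le> card {g \<in> greedy \<I> c es. c g \<le> k}"
proof (rule ccontr)
  let ?G = "greedy \<I> c es"
  assume "\<not> ?thesis"
  moreover have "{g \<in> ?G. c g \<le> k} \<in> \<I>" "{b \<in> B. c b \<le> k} \<in> \<I>"
    using greedy_indep assms(2) by (auto intro: indep_hereditary)
  ultimately obtain j
    where j: "j \<in> {b \<in> B. c b \<le> k} - {g \<in> ?G. c g \<le> k}"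
      "insert j {g \<in> ?G. c g \<le> k} \<in> \<I>"
    using augmentation[of "{g \<in> ?G. c g \<le> k}" "{b \<in> B. c b \<le> k}"] by auto
  have "j \<in> set es" "j \<notin> ?G"
    using j(1) assms indep_subset_ground by auto
  then have "insert j {g \<in> ?G. c g \<le> c j} \<notin> \<I>"
    by (rule greedy_rejected)
  \<comment> \<open>Since \<open>c j\<close> \<le> \<open>k\<close>, the elements that block
    \<open>j\<close> all survive the cut at \<open>k\<close>.\<close>
  moreover have "insert j {g \<in> ?G. c g \<le> c j} \<subseteq> insert j {g \<in> ?G. c g \<le> k}"
    using j(1) by auto
  ultimately show False
    using j(2) indep_hereditary by blast
qed

end

text \<open>Counting at the threshold \<open>ys ! i\<close>: if \<open>xs ! i\<close> exceeded it,
  at most \<open>i\<close> entries of \<open>xs\<close> would lie below or at it, but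
  \<open>ys\<close> has at least \<open>i + 1\<close> such entries, at positions 0 to
  \<open>i\<close>.\<close>

lemma sorted_nth_le_if_length_filter_le:
  fixes xs ys :: "'a::linorder list"
  assumes "sorted xs" "sorted ys" "length xs = length ys" "i < length ys"
    and le: "\<And>k. length (filter (\<lambda>y. y \<le> k) ys) \<le> length (filter (\<lambda>x. x \<le> k) xs)"
  shows "xs ! i \<le> ys ! i"
proof (rule ccontr)
  let ?k = "ys ! i"
  assume "\<not> ?thesis"
  then have "j < i" if "j < length xs" "xs ! j \<le> ?k" for j
    using that sorted_nth_mono[OF assms(1), of i j] by (meson leI order_trans)
  then have "{j. j < length xs \<and> xs ! j \<le> ?k} \<subseteq> {..<i}"
    by blast
  then have "length (filter (\<lambda>x. x \<le> ?k) xs) \<le> i"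
    using card_mono[of "{..<i}" "{j. j < length xs \<and> xs ! j \<le> ?k}"]
    by (simp add: length_filter_conv_card)
  moreover have "{..i} \<subseteq> {j. j < length ys \<and> ys ! j \<le> ?k}"
    using assms(2,4) by (auto intro: sorted_nth_mono)
  then have "Suc i \<le> length (filter (\<lambda>y. y \<le> ?k) ys)"
    using card_mono[of "{j. j < length ys \<and> ys ! j \<le> ?k}" "{..i}"]
    by (simp add: length_filter_conv_card)
  ultimately show False
    using le[of ?k] by simp
qed

lemma sorted_outcome: "sorted (outcome c B)"
  by (simp add: outcome_def)

lemma length_outcome: "length (outcome c B) = card B"
  by (simp add: outcome_def flip: size_mset)

text \<open>Translates counts of vector entries into sizes of category classes. Finiteness matters
  because \<open>mset_set\<close> of an infinite set is empty.\<close>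

lemma length_filter_outcome:
  assumes "finite B"
  shows "length (filter P (outcome c B)) = card {b \<in> B. P (c b)}"
  using assms by (simp add: outcome_def filter_mset_image_mset flip: size_mset)

lemma (in matroid) outcome_greedy_nth_le:
  assumes "set es = E" "B \<in> bases \<I>" "card B = card (greedy \<I> c es)" "i < card B"
  shows "outcome c (greedy \<I> c es) ! i \<le> outcome c B ! i"
proof -
  have "B \<in> \<I>"
    using assms(2) by (simp add: bases_def)
  show ?thesis
  proof (rule sorted_nth_le_if_length_filter_le)
    show "length (filter (\<lambda>y. y \<le> k) (outcome c B))
        \<le> length (filter (\<lambda>x. x \<le> k) (outcome c (greedy \<I> c es)))" for k
      using card_lower_le_greedy[OF assms(1) \<open>B \<in> \<I>\<close>] \<open>B \<in> \<I>\<close> greedy_indep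
      by (simp add: length_filter_outcome indep_finite)
  qed (use assms(3,4) in \<open>simp_all add: sorted_outcome length_outcome\<close>)
qed

theorem corollary5:
  fixes E :: "'a set" and \<I> :: "'a set set" and r K :: nat
    and c :: "'a \<Rightarrow> nat" and es :: "'a list"
  assumes "matroid E \<I>"
    and "\<And>B. B \<in> bases \<I> \<Longrightarrow> card B = r"
    and "c ` E \<subseteq> {1..K}"
    and "set es = E" and "distinct es"
  shows "greedy \<I> c es \<in> efficient_bases \<I> r c
    \<and> nondominated_set \<I> r c = {outcome c (greedy \<I> c es)}"
proof -
  interpret matroid E \<I> by fact
  let ?G = "greedy \<I> c es"
  have G: "?G \<in> bases \<I>"
    using assms(4) by (rule greedy_in_bases)
  have le: "outcome c ?G ! i \<le> outcome c B ! i" if "B \<in> bases \<I>" "i < r" for B i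
    using outcome_greedy_nth_le[OF assms(4)] that assms(2) G by simp
  \<comment> \<open>A dominating \<open>B\<close> would be componentwise at most \<open>?G\<close>;
    with \<open>le\<close>, antisymmetry makes the outcomes equal, which dominance excludes.\<close>
  have "\<not> ordinally_dominates r c B ?G" if B: "B \<in> bases \<I>" for B
  proof
    assume dom: "ordinally_dominates r c B ?G"
    have "outcome c B = outcome c ?G"
    proof (rule nth_equalityI)
      show "length (outcome c B) = length (outcome c ?G)"
        using assms(2)[OF B] assms(2)[OF G] by (simp add: length_outcome)
      fix i assume "i < length (outcome c B)"
      then have "i < r"
        using assms(2)[OF B] by (simp add: length_outcome)
      then show "outcome c B ! i = outcome c ?G ! i"
        using dom le[OF B] by (simp add: ordinally_dominates_def order_antisym)
    qed
    with dom show False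
      by (simp add: ordinally_dominates_def)
  qed
  then have eff: "?G \<in> efficient_bases \<I> r c"
    using G by (simp add: efficient_bases_def)
  \<comment> \<open>By \<open>le\<close>, \<open>?G\<close> dominates every basis with a different
    outcome, so an efficient basis must share the outcome of \<open>?G\<close>.\<close>
  have "outcome c B = outcome c ?G" if "B \<in> efficient_bases \<I> r c" for B
    using that G le[of B] by (auto simp: efficient_bases_def ordinally_dominates_def)
  then have "nondominated_set \<I> r c \<subseteq> {outcome c ?G}"
    unfolding nondominated_set_def by blast
  moreover have "outcome c ?G \<in> nondominated_set \<I> r c"
    using eff unfolding nondominated_set_def by (rule imageI)
  ultimately show ?thesis
    using eff by blast
qed

end
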